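(* Let $d$ be a positive integer, let $g\in\mathbb{N}$, and let $\preceq$ be a relaxed monomial order in $\mathbb{N}^d$. Then the directed graph $\mathcal{T}_{g,\preceq}^{d}$ is a rooted tree with root $R_{g,d}(\preceq)$. Moreover, if $T\in\mathcal{S}_{g,d}$, then the sons of $T$ in $\mathcal{T}_{g,\preceq}^{d}$ are the semigroups of the form $(T\cup\{\mathbf{h}\})\setminus\{\mathbf{x}\}$ with $\mathbf{h}\in\operatorname{SG}(T)$, $\mathbf{h}\prec\mathbf{m}_\preceq(T)$, and $\mathbf{x}\in\operatorname{U}_\preceq(T\cup\{\mathbf{h}\})\setminus\{\mathbf{h}\}$.
   Context: $\mathbb{N}$ is the set of non-negative integers. A generalized numerical semigroup (GNS) in $\mathbb{N}^d$ is a submonoid $S$ of $\mathbb{N}^d$ such that $\operatorname{H}(S)=\mathbb{N}^d\setminus S$ is finite; the elements of $\operatorname{H}(S)$ are the gaps of $S$, and the genus of $S$ is $|\operatorname{H}(S)|$. $\mathcal{S}_{g,d}$ is the set of all GNSs in $\mathbb{N}^d$ of genus $g$. A relaxed monomial order in $\mathbb{N}^d$ is a total order $\preceq$ on $\mathbb{N}^d$ such that (i) if $\mathbf{v}\preceq\mathbf{w}$ then $\mathbf{v}\preceq\mathbf{w}+\mathbf{u}$ for all $\mathbf{u}\in\mathbb{N}^d$; (ii) $\mathbf{0}\preceq\mathbf{v}$ for every $\mathbf{v}\neq\mathbf{0}$. Such an order is a well-ordering. $\prec$ denotes the strict order. Given a GNS $S$: the set of minimal generators is $\mathcal{A}(S)=S^*\setminus(S^*+S^*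 )$, where $S^*=S\setminus\{\mathbf{0}\}$; the multiplicity $\mathbf{m}_\preceq(S)$ is the $\preceq$-smallest element of $S\setminus\{\mathbf{0}\}$; the Frobenius element $\mathbf{F}_\preceq(S)$ is the $\preceq$-greatest element of $\operatorname{H}(S)$, with the convention $\mathbf{F}_\preceq(\mathbb{N}^d)=(-1,\ldots,-1)$, regarded as smaller than every element of $\mathbb{N}^d$; $\operatorname{U}_\preceq(S)$ is the set of minimal generators of $S$ greater than $\mathbf{F}_\preceq(S)$ with respect to $\preceq$; and the set of special gaps is $\operatorname{SG}(S)=\{\mathbf{h}\in\operatorname{H}(S)\mid 2\mathbf{h}\in S,\ \mathbf{h}+\mathbf{s}\in S\text{ for all }\mathbf{s}\in S\setminus\{\mathbf{0}\}\}$. (If $\mathbf{h}\in\operatorname{SG}(T)$ then $T\cup\{\mathbf{h}\}$ is a GNS.) A GNS is ordinary with respect to $\preceq$ if it has the form $\{\mathbf{x}\in\mathbb{N}^d\mid\mathbf{s}\prec\mathbf{x}\}\cup\{\mathbf{0}\}$ for some $\mathbf{s}\in\mathbb{N}^d$ such that $\{\mathbf{t}\in\mathbb{N}^d\mid\mathbf{t}\preceq\mathbf{s}\}$ is finite. If $\mathbf{0}=\mathbf{s}_0\prec\mathbf{s}_1\prec\cdots\prec\mathbf{s}_g$ are the first $g+1$ elements of $\mathbb{N}^d$ ordered by $\preceq$, then $R_{g,d}(\preceq)=\{\mathbf{x}\in\mathbb{N}^d\mid\mathbf{s}_g\prec\mathbf{x}\}\cup\{\mathbf{0}\}$ is the ordinary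 GNS of genus $g$ with respect to $\preceq$. The ordinarization transform $\mathcal{O}_\preceq:\mathcal{S}_{g,d}\to\mathcal{S}_{g,d}$ is given by $\mathcal{O}_\preceq(S)=(S\cup\{\mathbf{F}_\preceq(S)\})\setminus\{\mathbf{m}_\preceq(S)\}$ if $S$ is not ordinary with respect to $\preceq$, and $\mathcal{O}_\preceq(S)=S$ otherwise. $\mathcal{T}_{g,\preceq}^{d}$ is the directed graph with vertex set $\mathcal{S}_{g,d}$ and edges the pairs $(S,\mathcal{O}_\preceq(S))$ with $S\in\mathcal{S}_{g,d}$, $S\neq R_{g,d}(\preceq)$. If $(S,T)$ is an edge, $S$ is called a son of $T$. Rooted tree is meant with edges directed towards the root: every vertex has a unique directed path to the root. *)

theory Defs
  imports "HOL-Analysis.Finite_Cartesian_Product" "Graph_Theory.Graph_Theory"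
begin

text \<open>
  \<open>\<nat>\<^sup>d\<close> is \<^typ>\<open>nat ^ 'd\<close> with \<open>d = CARD('d)\<close>, which is automatically positive. An order
  \<open>\<preceq>\<close> is the set \<open>r\<close> of pairs \<open>(v, w)\<close> with \<open>v \<preceq> w\<close>.
\<close>

definition relaxed_monomial_order :: "(nat ^ 'd) rel \<Rightarrow> bool" where
  "relaxed_monomial_order r \<longleftrightarrow>
     linear_order r \<and>
     (\<forall>v w. (v, w) \<in> r \<longrightarrow> (\<forall>u. (v, w + u) \<in> r)) \<and>
     (\<forall>v. v \<noteq> 0 \<longrightarrow> (0, v) \<in> r)"

abbreviation strictly_below :: "'a \<Rightarrow> 'a rel \<Rightarrow> 'a \<Rightarrow> bool"
    (\<open>_ \<prec>\<^bsub>_\<^esub> _\<close> [51, 0, 51] 50) where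
  "v \<prec>\<^bsub>r\<^esub> w \<equiv> (v, w) \<in> r \<and> v \<noteq> w"

definition least_wrt :: "'a rel \<Rightarrow> 'a set \<Rightarrow> 'a" where
  "least_wrt r A = (THE x. x \<in> A \<and> (\<forall>y\<in>A. (x, y) \<in> r))"

definition greatest_wrt :: "'a rel \<Rightarrow> 'a set \<Rightarrow> 'a" where
  "greatest_wrt r A = (THE x. x \<in> A \<and> (\<forall>y\<in>A. (y, x) \<in> r))"

definition gaps :: "(nat ^ 'd) set \<Rightarrow> (nat ^ 'd) set" where
  "gaps S = UNIV - S"

definition gns :: "(nat ^ 'd) set \<Rightarrow> bool" where
  "gns S \<longleftrightarrow> 0 \<in> S \<and> (\<forall>x\<in>S. \<forall>y\<in>S. x + y \<in> S) \<and> finite (gaps S)"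

definition genus :: "(nat ^ 'd) set \<Rightarrow> nat" where
  "genus S = card (gaps S)"

definition gns_of_genus :: "nat \<Rightarrow> (nat ^ 'd) set set" where
  "gns_of_genus g = {S. gns S \<and> genus S = g}"

definition minimal_generators :: "(nat ^ 'd) set \<Rightarrow> (nat ^ 'd) set" where
  "minimal_generators S = (S - {0}) - {a + b | a b. a \<in> S - {0} \<and> b \<in> S - {0}}"

definition multiplicity :: "(nat ^ 'd) rel \<Rightarrow> (nat ^ 'd) set \<Rightarrow> nat ^ 'd" where
  "multiplicity r S = least_wrt r (S - {0})"

definition special_gaps :: "(nat ^ 'd) set \<Rightarrow> (nat ^ 'd) set" where
  "special_gaps S = {h \<in> gaps S. 2 *s h \<in> S \<and> (\<forall>s \<in> S - {0}. h + s \<in> S)}"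

text \<open>
  The Frobenius element lives in \<open>\<int>\<^sup>d\<close>, because that of \<open>\<nat>\<^sup>d\<close> is \<open>(-1, \<dots>, -1)\<close> by convention.
\<close>

definition int_vec :: "nat ^ 'd \<Rightarrow> int ^ 'd" where
  "int_vec v = (\<chi> i. int (v $ i))"

definition frobenius :: "(nat ^ 'd) rel \<Rightarrow> (nat ^ 'd) set \<Rightarrow> int ^ 'd" where
  "frobenius r S =
     (if gaps S = {} then (\<chi> i. -1) else int_vec (greatest_wrt r (gaps S)))"

text \<open>The strict order, extended on the left by \<open>(-1, \<dots>, -1)\<close> as a new bottom element.\<close>

definition ext_below :: "(nat ^ 'd) rel \<Rightarrow> int ^ 'd \<Rightarrow> nat ^ 'd \<Rightarrow> bool" where
  "ext_below r z a \<longleftrightarrow> z = (\<chi> i. -1) \<or> (\<exists>u. z = int_vec u \<and> u \<prec>\<^bsub>r\<^esub> a)"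

definition effective_generators :: "(nat ^ 'd) rel \<Rightarrow> (nat ^ 'd) set \<Rightarrow> (nat ^ 'd) set" where
  "effective_generators r S = {a \<in> minimal_generators S. ext_below r (frobenius r S) a}"

definition ordinary :: "(nat ^ 'd) rel \<Rightarrow> (nat ^ 'd) set \<Rightarrow> bool" where
  "ordinary r S \<longleftrightarrow> (\<exists>s. finite {t. (t, s) \<in> r} \<and> S = {x. s \<prec>\<^bsub>r\<^esub> x} \<union> {0})"

primrec nth_element :: "'a rel \<Rightarrow> nat \<Rightarrow> 'a" where
  "nth_element r 0 = least_wrt r UNIV"
| "nth_element r (Suc n) = least_wrt r {x. nth_element r n \<prec>\<^bsub>r\<^esub> x}"

definition ordinary_gns :: "(nat ^ 'd) rel \<Rightarrow> nat \<Rightarrow> (nat ^ 'd) set" where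
  "ordinary_gns r g = {x. nth_element r g \<prec>\<^bsub>r\<^esub> x} \<union> {0}"

text \<open>
  The set \<open>{v. int_vec v = frobenius r S}\<close> is the singleton of the Frobenius element, pulled back
  to \<open>\<nat>\<^sup>d\<close>; a non-ordinary semigroup has a gap, so its Frobenius element is not \<open>(-1, \<dots>, -1)\<close>.
\<close>

definition ordinarization :: "(nat ^ 'd) rel \<Rightarrow> (nat ^ 'd) set \<Rightarrow> (nat ^ 'd) set" where
  "ordinarization r S =
     (if ordinary r S then S
      else (S \<union> {v. int_vec v = frobenius r S}) - {multiplicity r S})"

definition ordinarization_graph ::
    "(nat ^ 'd) rel \<Rightarrow> nat \<Rightarrow> ((nat ^ 'd) set, (nat ^ 'd) set \<times> (nat ^ 'd) set) pre_digraph" where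
  "ordinarization_graph r g =
     \<lparr> verts = gns_of_genus g,
       arcs = {(S, ordinarization r S) | S. S \<in> gns_of_genus g \<and> S \<noteq> ordinary_gns r g},
       tail = fst,
       head = snd \<rparr>"

definition sons :: "('a, 'b) pre_digraph \<Rightarrow> 'a \<Rightarrow> 'a set" where
  "sons G T = {S. S \<rightarrow>\<^bsub>G\<^esub> T}"

text \<open>
  Arcs point towards the root. Uniqueness is required among all directed walks, the empty one from
  the root to itself included; hence the walk does not repeat a vertex, and loops and directed
  cycles are excluded.
\<close>

definition rooted_tree :: "('a, 'b) pre_digraph \<Rightarrow> 'a \<Rightarrow> bool" where
  "rooted_tree G R \<longleftrightarrow>
     wf_digraph G \<and> R \<in> verts G \<and> (\<forall>v \<in> verts G. \<exists>!p. pre_digraph.awalk G v p R)"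

end

theory Submission
  imports Defs
begin

text \<open>
  If \<open>S\<close> is not ordinary, then \<open>m(S) \<prec> F(S)\<close>. The element \<open>F(S)\<close> is a special gap of \<open>S\<close>, and
  \<open>m(S)\<close> is still the multiplicity, hence a minimal generator, after \<open>F(S)\<close> has been adjoined;
  so exchanging them gives a GNS of the same genus. If \<open>S \<noteq> R\<close>, the exchange replaces
  a gap of \<open>S\<close> outside the gaps of \<open>R\<close> by one inside, so iteration reaches \<open>R\<close>, and
  walks are unique because every non-root vertex has exactly one outgoing arc and the root none.
  A son \<open>S\<close> of \<open>T\<close> is recovered from \<open>h = m(S)\<close> and \<open>x = F(S)\<close>. That \<open>\<preceq>\<close> is a well-order is
  Dickson's lemma.
\<close>

section \<open>Rooted trees\<close>

text \<open>Since \<open>\<mu>\<close> drops along every arc, following the arcs out of non-root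
  vertices must stop, and can stop only at \<open>R\<close>. By \<open>det\<close> two walks to
  \<open>R\<close> agree arc by arc, and by \<open>root\<close> neither continues after reaching
  \<open>R\<close>.\<close>

lemma rooted_treeI:
  fixes \<mu> :: "'a \<Rightarrow> nat"
  assumes wf: "wf_digraph G" and R: "R \<in> verts G"
    and root: "\<And>e. e \<in> arcs G \<Longrightarrow> tail G e \<noteq> R"
    and ex: "\<And>v. v \<in> verts G \<Longrightarrow> v \<noteq> R \<Longrightarrow> \<exists>e\<in>arcs G. tail G e = v"
    and det: "\<And>e e'. e \<in> arcs G \<Longrightarrow> e' \<in> arcs G \<Longrightarrow> tail G e = tail G e' \<Longrightarrow> e = e'"
    and decr: "\<And>e. e \<in> arcs G \<Longrightarrow> \<mu> (head G e) < \<mu> (tail G e)"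
  shows "rooted_tree G R"
proof -
  interpret wf_digraph G by (rule wf)
  have walk: "\<exists>p. awalk v p R" if "v \<in> verts G" for v
    using that
  proof (induction "\<mu> v" arbitrary: v rule: less_induct)
    case less
    show ?case
    proof (cases "v = R")
      case True
      with R show ?thesis by (auto intro: awalk_Nil_iff[THEN iffD2])
    next
      case False
      then obtain e where e: "e \<in> arcs G" "tail G e = v" using ex less.prems by blast
      then obtain p where "awalk (head G e) p R"
        using less.hyps[of "head G e"] decr[of e] by auto
      with e have "awalk v (e # p) R" by (simp add: awalk_Cons_iff)
      then show ?thesis ..
    qed
  qed
  have uniq: "p = q" if "awalk v p R" "awalk v q R" for v p q
    using that
  proof (induction p arbitrary: v q)
    case Nil
    then show ?case using root by (cases q) (auto simp: awalk_Cons_iff awalk_Nil_iff)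
  next
    case (Cons e p)
    then obtain e' q' where q: "q = e' # q'"
      using root by (cases q) (auto simp: awalk_Cons_iff awalk_Nil_iff)
    with Cons.prems have "e = e'" using det by (auto simp: awalk_Cons_iff)
    with Cons q show ?case by (auto simp: awalk_Cons_iff)
  qed
  show ?thesis unfolding rooted_tree_def using wf R walk uniq by blast
qed

section \<open>Dickson's lemma\<close>

lemma nat_incseq_subseq:
  fixes f :: "nat \<Rightarrow> nat"
  shows "\<exists>\<phi>. strict_mono \<phi> \<and> incseq (f \<circ> \<phi>)"
proof -
  obtain \<phi> where \<phi>: "strict_mono \<phi>" "monoseq (\<lambda>n. f (\<phi> n))"
    using seq_monosub by blast
  from \<phi>(2) consider "incseq (f \<circ> \<phi>)" | "decseq (\<lambda>n. f (\<phi> n))"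
    by (auto simp: monoseq_def incseq_def decseq_def)
  then show ?thesis
  proof cases
    case 1
    with \<phi> show ?thesis by blast
  next
    case 2
    \<comment> \<open>An index where the decreasing sequence attains its minimum; from there on it
      is constant, so dropping the first \<open>k\<close> terms suffices.\<close>
    define k where "k = (ARG_MIN (\<lambda>n. f (\<phi> n)) n. True)"
    have k: "f (\<phi> k) \<le> f (\<phi> n)" for n
      unfolding k_def by (rule arg_min_nat_le) simp
    have "f (\<phi> (n + k)) = f (\<phi> k)" for n
      using k[of "n + k"] decseqD[OF 2, of k "n + k"] by simp
    then have "incseq (f \<circ> (\<lambda>n. \<phi> (n + k)))" by (simp add: incseq_def)
    moreover have "strict_mono (\<lambda>n. \<phi> (n + k))"
      using \<phi>(1) by (simp add: strict_mono_def)
    ultimately show ?thesis by blast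
  qed
qed

text \<open>Dickson's lemma for sequences: thin out for one coordinate at a time; a further
  subsequence keeps the earlier coordinates increasing.\<close>

lemma vec_incseq_subseq:
  fixes f :: "nat \<Rightarrow> nat ^ 'd"
  shows "\<exists>\<phi>. strict_mono \<phi> \<and> (\<forall>i. incseq (\<lambda>n. f (\<phi> n) $ i))"
proof -
  have "\<exists>\<phi>. strict_mono \<phi> \<and> (\<forall>i\<in>K. incseq (\<lambda>n. f (\<phi> n) $ i))" if "finite K" for K :: "'d set"
    using that
  proof induction
    case empty
    show ?case by (auto intro: strict_mono_id)
  next
    case (insert k K)
    then obtain \<phi> where \<phi>: "strict_mono \<phi>" "\<forall>i\<in>K. incseq (\<lambda>n. f (\<phi> n) $ i)" by blast
    obtain \<psi> where \<psi>: "strict_mono \<psi>" "incseq ((\<lambda>n. f (\<phi> n) $ k) \<circ> \<psi>)"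
      using nat_incseq_subseq by blast
    have "incseq (\<lambda>n. f (\<phi> (\<psi> n)) $ i)" if "i \<in> insert k K" for i
      using that \<phi>(2) \<psi>
      by (fastforce simp: incseq_def strict_mono_less_eq)
    moreover have "strict_mono (\<phi> \<circ> \<psi>)" using \<phi>(1) \<psi>(1) by (rule strict_mono_o)
    ultimately show ?case by (intro exI[of _ "\<phi> \<circ> \<psi>"]) (simp add: comp_def)
  qed
  from this[of UNIV] show ?thesis by simp
qed

text \<open>The constant vectors are pairwise distinct. Infinitude guarantees a nonzero element in
  every GNS and a next element in the enumeration by the order.\<close>

lemma infinite_UNIV_nat_vec: "infinite (UNIV :: (nat ^ 'd) set)"
proof
  assume "finite (UNIV :: (nat ^ 'd) set)"
  then have "finite (range (vec :: nat \<Rightarrow> nat ^ 'd))" by (rule finite_subset[rotated]) simp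
  moreover have "inj (vec :: nat \<Rightarrow> nat ^ 'd)" by (simp add: inj_def vec_eq_iff)
  ultimately show False using finite_imageD by auto
qed

section \<open>Generalized numerical semigroups\<close>

lemma int_vec_eq_iff: "int_vec u = int_vec v \<longleftrightarrow> u = v"
  by (auto simp: int_vec_def vec_eq_iff)

lemma int_vec_neq_minus_one: "int_vec u \<noteq> (\<chi> i. -1)"
  by (auto simp: int_vec_def vec_eq_iff)

lemma two_scale: "2 *s h = h + h" for h :: "nat ^ 'd"
  by (simp add: vec_eq_iff)

lemma gns_zero: "gns S \<Longrightarrow> 0 \<in> S"
  and gns_add: "gns S \<Longrightarrow> x \<in> S \<Longrightarrow> y \<in> S \<Longrightarrow> x + y \<in> S"
  and gns_finite_gaps: "gns S \<Longrightarrow> finite (gaps S)"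
  by (auto simp: gns_def)

lemma gns_nonzero:
  assumes "gns S"
  shows "S - {0} \<noteq> {}"
proof
  assume "S - {0} = {}"
  then have "UNIV = gaps S \<union> {0}" by (auto simp: gaps_def)
  with gns_finite_gaps[OF assms] infinite_UNIV_nat_vec show False
    by (metis finite.emptyI finite_Un finite_insert)
qed

text \<open>The only new sums are \<open>h + h\<close> and \<open>h + s\<close>, which the
  definition of a special gap controls; \<open>s = 0\<close> gives \<open>h\<close> itself.\<close>

lemma gns_insert_special_gap:
  assumes S: "gns S" and h: "h \<in> special_gaps S"
  shows "gns (insert h S)"
proof -
  have hh: "h + h \<in> S" and hs: "\<And>s. s \<in> S \<Longrightarrow> s \<noteq> 0 \<Longrightarrow> h + s \<in> S"
    using h by (auto simp: special_gaps_def two_scale)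
  have hs': "h + s \<in> insert h S" if "s \<in> S" for s
    using hs that by (cases "s = 0") auto
  have "x + y \<in> insert h S" if "x \<in> insert h S" "y \<in> insert h S" for x y
  proof (cases "x = h")
    case True
    with that hh hs' show ?thesis by auto
  next
    case False
    then show ?thesis using that hs'[of x] gns_add[OF S]
      by (cases "y = h") (auto simp: add.commute)
  qed
  moreover have "finite (gaps (insert h S))"
    using gns_finite_gaps[OF S] by (rule finite_subset[rotated]) (auto simp: gaps_def)
  ultimately show ?thesis using gns_zero[OF S] by (auto simp: gns_def)
qed

text \<open>Two nonzero summands cannot give \<open>x\<close> by minimality; if one summand is zero,
  the sum is the other one, which differs from \<open>x\<close>.\<close>

lemma gns_remove_minimal_generator:
  assumes S: "gns S" and x: "x \<in> minimal_generators S"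
  shows "gns (S - {x})"
proof -
  have "a + b \<noteq> x" if "a \<in> S - {x}" "b \<in> S - {x}" for a b
    using that x by (cases "a = 0 \<or> b = 0") (auto simp: minimal_generators_def)
  moreover have "gaps (S - {x}) = insert x (gaps S)" by (auto simp: gaps_def)
  ultimately show ?thesis using S x by (auto simp: gns_def minimal_generators_def)
qed

lemma genus_exchange:
  assumes "gns S" "h \<notin> S" "x \<in> S"
  shows "genus (insert h S - {x}) = genus S"
proof -
  have "gaps (insert h S - {x}) = insert x (gaps S - {h})" and "h \<in> gaps S" and "x \<notin> gaps S"
    using assms by (auto simp: gaps_def)
  then show ?thesis
    using gns_finite_gaps[OF assms(1)] card_Suc_Diff1[of "gaps S" h] by (simp add: genus_def)
qed

section \<open>Relaxed monomial orders\<close>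

locale relaxed_order =
  fixes r :: "(nat ^ 'd) rel"
  assumes relaxed: "relaxed_monomial_order r"
begin

lemma le_refl: "(v, v) \<in> r"
  and le_trans: "(u, v) \<in> r \<Longrightarrow> (v, w) \<in> r \<Longrightarrow> (u, w) \<in> r"
  and le_antisym: "(v, w) \<in> r \<Longrightarrow> (w, v) \<in> r \<Longrightarrow> v = w"
  using relaxed
  by (auto simp: relaxed_monomial_order_def order_on_defs total_on_def refl_on_def
      dest: transD antisymD)

lemma le_total: "(v, w) \<in> r \<or> (w, v) \<in> r"
  using relaxed le_refl
  by (cases "v = w") (auto simp: relaxed_monomial_order_def order_on_defs total_on_def)

text \<open>Condition (i) applied to \<open>(v, v) \<in> r\<close>. Compatibility with addition
  enters all later arguments in this form.\<close>

lemma le_add: "(v, v + u) \<in> r"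
  using relaxed le_refl[of v] by (auto simp: relaxed_monomial_order_def)

lemma zero_le: "(0, v) \<in> r"
  using le_add[of 0 v] by simp

text \<open>A strictly descending sequence would have a coordinatewise increasing subsequence; its
  later terms are the earlier ones plus a vector, hence not below them.\<close>

lemma wf_strict: "wf (r - Id)"
  unfolding wf_iff_no_infinite_down_chain
proof
  assume "\<exists>f. \<forall>i. (f (Suc i), f i) \<in> r - Id"
  then obtain f where f: "\<And>i. f (Suc i) \<prec>\<^bsub>r\<^esub> f i" by auto
  have desc: "f (Suc i + j) \<prec>\<^bsub>r\<^esub> f i" for i j
    by (induction j) (use f le_trans le_antisym in \<open>simp, metis add_Suc_right add_Suc\<close>)
  obtain \<phi> where \<phi>: "strict_mono \<phi>" "\<And>i. incseq (\<lambda>n. f (\<phi> n) $ i)"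
    using vec_incseq_subseq by blast
  \<comment> \<open>Truncated subtraction is harmless here, because each coordinate grows from
    \<open>\<phi> 0\<close> to \<open>\<phi> 1\<close>.\<close>
  have "f (\<phi> 1) = f (\<phi> 0) + (\<chi> i. f (\<phi> 1) $ i - f (\<phi> 0) $ i)"
    using incseqD[OF \<phi>(2), of 0 1] by (simp add: vec_eq_iff)
  then have "(f (\<phi> 0), f (\<phi> 1)) \<in> r" by (metis le_add)
  moreover have "\<phi> 0 < \<phi> 1" using \<phi>(1) by (simp add: strict_mono_def)
  then obtain j where "\<phi> 1 = Suc (\<phi> 0) + j" using less_iff_Suc_add by auto
  with desc have "f (\<phi> 1) \<prec>\<^bsub>r\<^esub> f (\<phi> 0)" by metis
  ultimately show False using le_antisym by blast
qed

lemma least_wrt_eqI: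
  assumes "x \<in> A" "\<And>y. y \<in> A \<Longrightarrow> (x, y) \<in> r"
  shows "least_wrt r A = x"
  unfolding least_wrt_def using assms le_antisym by (intro the_equality) blast+

lemma greatest_wrt_eqI:
  assumes "x \<in> A" "\<And>y. y \<in> A \<Longrightarrow> (y, x) \<in> r"
  shows "greatest_wrt r A = x"
  unfolding greatest_wrt_def using assms le_antisym by (intro the_equality) blast+

lemma least_wrt:
  assumes "A \<noteq> {}"
  shows "least_wrt r A \<in> A" and "y \<in> A \<Longrightarrow> (least_wrt r A, y) \<in> r"
proof -
  obtain x where x: "x \<in> A" "\<And>y. (y, x) \<in> r - Id \<Longrightarrow> y \<notin> A"
    using wfE_min[OF wf_strict] assms by (metis all_not_in_conv)
  then have "(x, y) \<in> r" if "y \<in> A" for y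
    using that le_total[of x y] le_refl by (cases "x = y") auto
  with x(1) have "least_wrt r A = x" by (intro least_wrt_eqI)
  then show "least_wrt r A \<in> A" and "y \<in> A \<Longrightarrow> (least_wrt r A, y) \<in> r"
    using x \<open>\<And>y. y \<in> A \<Longrightarrow> (x, y) \<in> r\<close> by auto
qed

lemma greatest_wrt:
  assumes "finite A" "A \<noteq> {}"
  shows "greatest_wrt r A \<in> A" and "y \<in> A \<Longrightarrow> (y, greatest_wrt r A) \<in> r"
proof -
  have "\<exists>x\<in>A. \<forall>y\<in>A. (y, x) \<in> r"
    using assms
  proof (induction rule: finite_ne_induct)
    case (insert a A)
    then obtain x where "x \<in> A" "\<forall>y\<in>A. (y, x) \<in> r" by blast
    with le_total[of a x] show ?case by (auto intro: le_trans le_refl)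
  qed (use le_refl in simp)
  then obtain x where x: "x \<in> A" "\<And>y. y \<in> A \<Longrightarrow> (y, x) \<in> r" by blast
  then have "greatest_wrt r A = x" by (intro greatest_wrt_eqI)
  with x show "greatest_wrt r A \<in> A" and "y \<in> A \<Longrightarrow> (y, greatest_wrt r A) \<in> r" by auto
qed

section \<open>Frobenius element and multiplicity\<close>

lemma frobenius_eqI:
  assumes "f \<in> gaps S" "\<forall>y\<in>gaps S. (y, f) \<in> r"
  shows "frobenius r S = int_vec f"
  using assms greatest_wrt_eqI[of f "gaps S"] by (auto simp: frobenius_def)

text \<open>Lying above the greatest gap is lying above all gaps. Without gaps the right side is
  vacuous, matching the bottom element \<open>-1\<close>. This removes integer vectors from later
  arguments.\<close>

lemma ext_below_frobenius_iff:
  assumes "gns S"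
  shows "ext_below r (frobenius r S) a \<longleftrightarrow> (\<forall>y\<in>gaps S. y \<prec>\<^bsub>r\<^esub> a)"
proof (cases "gaps S = {}")
  case True
  then show ?thesis by (simp add: ext_below_def frobenius_def)
next
  case False
  note F = greatest_wrt[OF gns_finite_gaps[OF assms] False]
  from F(1) F(2) have "(\<forall>y\<in>gaps S. y \<prec>\<^bsub>r\<^esub> a) \<longleftrightarrow> greatest_wrt r (gaps S) \<prec>\<^bsub>r\<^esub> a"
    by (metis le_trans le_antisym)
  with False show ?thesis
    by (auto simp: ext_below_def frobenius_def int_vec_eq_iff int_vec_neq_minus_one)
qed

lemma multiplicity:
  assumes "gns S"
  shows "multiplicity r S \<in> S" and "multiplicity r S \<noteq> 0"
    and "y \<in> S \<Longrightarrow> y \<noteq> 0 \<Longrightarrow> (multiplicity r S, y) \<in> r"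
  using least_wrt[OF gns_nonzero[OF assms]] by (auto simp: multiplicity_def)

text \<open>If the multiplicity were \<open>a + b\<close>, minimality would put it below
  \<open>a\<close>, while \<open>a\<close> is below \<open>a + b\<close>; so
  \<open>b = 0\<close>.\<close>

lemma multiplicity_minimal_generator:
  assumes "gns S"
  shows "multiplicity r S \<in> minimal_generators S"
proof -
  have "multiplicity r S \<noteq> a + b" if "a \<in> S - {0}" "b \<in> S - {0}" for a b
  proof
    assume eq: "multiplicity r S = a + b"
    have "(a + b, a) \<in> r" using multiplicity(3)[OF assms, of a] that eq by auto
    then have "a + b = a" using le_add le_antisym by blast
    with that show False by simp
  qed
  then show ?thesis using multiplicity(1,2)[OF assms] by (auto simp: minimal_generators_def)
qed

lemma greatest_gap_special:
  assumes S: "gns S" and f: "f \<in> gaps S" "\<forall>y\<in>gaps S. (y, f) \<in> r"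
  shows "f \<in> special_gaps S"
proof -
  have "f \<noteq> 0" using f(1) gns_zero[OF S] by (auto simp: gaps_def)
  \<comment> \<open>Here \<open>s\<close> is any nonzero vector, in \<open>S\<close> or not;
    \<open>s = f\<close> yields the condition on \<open>2 *s f\<close>.\<close>
  have "f + s \<in> S" if "s \<noteq> 0" for s
  proof (rule ccontr)
    assume "f + s \<notin> S"
    then have "(f + s, f) \<in> r" using f(2) by (simp add: gaps_def)
    then have "f + s = f" using le_add le_antisym by blast
    with that show False by simp
  qed
  with \<open>f \<noteq> 0\<close> f(1) show ?thesis by (auto simp: special_gaps_def two_scale)
qed

lemma multiplicity_insert:
  assumes S: "gns S" and h: "h \<in> special_gaps S" and "(multiplicity r S, h) \<in> r"
  shows "multiplicity r (insert h S) = multiplicity r S"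
  unfolding multiplicity_def[of r "insert h S"]
  by (rule least_wrt_eqI) (use multiplicity[OF S] assms(3) in auto)

section \<open>Ordinary semigroups\<close>

text \<open>The nonzero elements of an ordinary semigroup are upward closed.\<close>

lemma not_ordinaryI:
  assumes "a \<in> S" "a \<noteq> 0" "b \<notin> S" "a \<prec>\<^bsub>r\<^esub> b"
  shows "\<not> ordinary r S"
proof
  assume "ordinary r S"
  then obtain s where S: "S = {x. s \<prec>\<^bsub>r\<^esub> x} \<union> {0}" unfolding ordinary_def by blast
  with assms(1,2) have "s \<prec>\<^bsub>r\<^esub> a" by blast
  then have "s \<prec>\<^bsub>r\<^esub> b" using assms(4) le_trans[of s a b] le_antisym[of s a] by auto
  with S assms(3) show False by blast
qed

text \<open>If the greatest gap \<open>f\<close> lay below the multiplicity, \<open>S\<close> would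
  consist of \<open>0\<close> and everything above \<open>f\<close>, hence be ordinary.\<close>

lemma not_ordinaryE:
  assumes S: "gns S" and "\<not> ordinary r S"
  obtains f where "f \<in> gaps S" "\<forall>y\<in>gaps S. (y, f) \<in> r" "multiplicity r S \<prec>\<^bsub>r\<^esub> f"
proof -
  \<comment> \<open>The full monoid is ordinary, with \<open>s = 0\<close>.\<close>
  have "gaps S \<noteq> {}"
  proof
    assume "gaps S = {}"
    then have "S = {x. 0 \<prec>\<^bsub>r\<^esub> x} \<union> {0}" using zero_le by (auto simp: gaps_def)
    moreover have "{t. (t, 0) \<in> r} = {0}" using zero_le le_antisym by blast
    then have "finite {t. (t, 0) \<in> r}" by simp
    ultimately show False using assms(2) unfolding ordinary_def by blast
  qed
  note F = greatest_wrt[OF gns_finite_gaps[OF S] this]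
  define f where "f = greatest_wrt r (gaps S)"
  have f: "f \<in> gaps S" "\<forall>y\<in>gaps S. (y, f) \<in> r"
    using F by (auto simp: f_def)
  have "multiplicity r S \<prec>\<^bsub>r\<^esub> f"
  proof (rule ccontr)
    assume "\<not> ?thesis"
    moreover have "multiplicity r S \<noteq> f" using multiplicity(1)[OF S] f(1) by (auto simp: gaps_def)
    ultimately have not_le: "(multiplicity r S, f) \<notin> r" by blast
    \<comment> \<open>A nonzero \<open>x \<in> S\<close> up to \<open>f\<close> would put the
      multiplicity below \<open>f\<close>. This bounds the initial segment of \<open>f\<close> and
      determines \<open>S\<close>.\<close>
    have gap: "x \<in> gaps S \<union> {0}" if "(x, f) \<in> r" for x
      using that not_le multiplicity(3)[OF S, of x] le_trans unfolding gaps_def by blast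
    have "{t. (t, f) \<in> r} \<subseteq> gaps S \<union> {0}" using gap by blast
    then have "finite {t. (t, f) \<in> r}"
      by (rule finite_subset) (simp add: gns_finite_gaps[OF S])
    moreover have "S = {x. f \<prec>\<^bsub>r\<^esub> x} \<union> {0}"
    proof (intro set_eqI iffI)
      fix x assume x: "x \<in> S"
      have "f \<prec>\<^bsub>r\<^esub> x" if "x \<noteq> 0"
      proof -
        have "(x, f) \<notin> r" using gap[of x] x that by (auto simp: gaps_def)
        then show ?thesis using le_total[of x f] le_refl[of x] by auto
      qed
      then show "x \<in> {x. f \<prec>\<^bsub>r\<^esub> x} \<union> {0}" by blast
    next
      fix x assume "x \<in> {x. f \<prec>\<^bsub>r\<^esub> x} \<union> {0}"
      then show "x \<in> S" using f(2) gns_zero[OF S] le_antisym[of x f] by (auto simp: gaps_def)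
    qed
    ultimately show False using assms(2) unfolding ordinary_def by blast
  qed
  with f that show thesis by blast
qed

text \<open>Indexing starts at \<open>0\<close>, so the initial segment of the \<open>n\<close>-th
  element has \<open>n + 1\<close> members; passing to the successor adds exactly that
  successor.\<close>

lemma down_nth_element:
  "finite {t. (t, nth_element r n) \<in> r} \<and>
   card {t. (t, nth_element r n) \<in> r} = Suc n"
proof (induction n)
  case 0
  have "nth_element r 0 = 0" using least_wrt_eqI[of 0 UNIV] zero_le by simp
  moreover have "{t. (t, 0) \<in> r} = {0}" using zero_le le_antisym by blast
  ultimately show ?case by simp
next
  case (Suc n)
  let ?s = "nth_element r n" and ?A = "{x. nth_element r n \<prec>\<^bsub>r\<^esub> x}"
  let ?t = "nth_element r (Suc n)"
  have "?A \<noteq> {}"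
  proof
    assume "?A = {}"
    then have "UNIV = {t. (t, ?s) \<in> r}" using le_total le_refl by blast
    with Suc infinite_UNIV_nat_vec show False by metis
  qed
  note t = least_wrt[OF this, folded nth_element.simps(2)]
  have "{x. (x, ?t) \<in> r} = insert ?t {x. (x, ?s) \<in> r}"
  proof (intro set_eqI iffI)
    fix x assume "x \<in> {x. (x, ?t) \<in> r}"
    then have x: "(x, ?t) \<in> r" by simp
    show "x \<in> insert ?t {x. (x, ?s) \<in> r}"
    proof (cases "(x, ?s) \<in> r")
      case False
      then have "x \<in> ?A" using le_total le_refl by blast
      then have "x = ?t" using t(2) x le_antisym by blast
      then show ?thesis by blast
    qed blast
  next
    fix x assume "x \<in> insert ?t {x. (x, ?s) \<in> r}"
    then show "x \<in> {x. (x, ?t) \<in> r}" using t(1) le_trans le_refl by blast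
  qed
  moreover have "?t \<notin> {x. (x, ?s) \<in> r}" using t(1) le_antisym by blast
  ultimately show ?case using Suc by (simp del: nth_element.simps)
qed

text \<open>The vector \<open>0\<close> lies in the initial segment but is no gap; hence the
  \<open>Suc\<close> in \<open>card_down\<close>.\<close>

lemma gaps_above: "gaps ({x. s \<prec>\<^bsub>r\<^esub> x} \<union> {0}) = {t. (t, s) \<in> r} - {0}"
  using le_total le_antisym le_refl unfolding gaps_def by blast

lemma ordinary_ordinary_gns: "ordinary r (ordinary_gns r g)"
  unfolding ordinary_def ordinary_gns_def using down_nth_element by blast

lemma card_down:
  assumes "finite {t. (t, s) \<in> r}"
  shows "card {t. (t, s) \<in> r} = Suc (genus ({x. s \<prec>\<^bsub>r\<^esub> x} \<union> {0}))"
  using card_Suc_Diff1[OF assms, of 0] zero_le by (simp only: genus_def gaps_above mem_Collect_eq)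

lemma ordinary_gns_mem: "ordinary_gns r g \<in> gns_of_genus g"
proof -
  let ?s = "nth_element r g"
  have "?s \<prec>\<^bsub>r\<^esub> x + y" if "?s \<prec>\<^bsub>r\<^esub> x" for x y
    using that le_add[of x y] by (metis le_trans le_antisym)
  then have "x + y \<in> ordinary_gns r g" if "x \<in> ordinary_gns r g" "y \<in> ordinary_gns r g" for x y
    using that by (auto simp: ordinary_gns_def)
  then have "gns (ordinary_gns r g)"
    using down_nth_element[of g] unfolding gns_def ordinary_gns_def gaps_above by simp
  moreover have "genus (ordinary_gns r g) = g"
    using card_down[of ?s] down_nth_element[of g] by (simp add: ordinary_gns_def)
  ultimately show ?thesis by (simp add: gns_of_genus_def)
qed

text \<open>Initial segments form a chain, so finite ones of equal size coincide, and then so do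
  their greatest elements.\<close>

lemma ordinary_unique:
  assumes "ordinary r S"
  shows "S = ordinary_gns r (genus S)"
proof -
  obtain s where s: "finite {t. (t, s) \<in> r}" and S: "S = {x. s \<prec>\<^bsub>r\<^esub> x} \<union> {0}"
    using assms unfolding ordinary_def by blast
  let ?t = "nth_element r (genus S)"
  have card: "card {t. (t, s) \<in> r} = card {t. (t, ?t) \<in> r}"
    using card_down[OF s] down_nth_element[of "genus S"] S by simp
  have "{t. (t, s) \<in> r} \<subseteq> {t. (t, ?t) \<in> r} \<or> {t. (t, ?t) \<in> r} \<subseteq> {t. (t, s) \<in> r}"
    using le_total[of s ?t] le_trans by blast
  then have "{t. (t, s) \<in> r} = {t. (t, ?t) \<in> r}"
    using card card_subset_eq s down_nth_element[of "genus S"] by metis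
  then have "s = ?t" using le_refl le_antisym by blast
  then show ?thesis by (subst S) (simp add: ordinary_gns_def)
qed

section \<open>The ordinarization transform\<close>

text \<open>Injectivity of \<open>int_vec\<close> turns the pulled-back Frobenius element into the
  greatest gap \<open>f\<close>.\<close>

lemma ordinarization_eq:
  assumes "\<not> ordinary r S" "f \<in> gaps S" "\<forall>y\<in>gaps S. (y, f) \<in> r"
  shows "ordinarization r S = insert f S - {multiplicity r S}"
  using assms frobenius_eqI[of f S] by (auto simp: ordinarization_def int_vec_eq_iff)

lemma ordinarization_mem:
  assumes S: "S \<in> gns_of_genus g"
  shows "ordinarization r S \<in> gns_of_genus g"
proof (cases "ordinary r S")
  case True
  with S show ?thesis by (simp add: ordinarization_def)
next
  case False
  from S have gns: "gns S" and "genus S = g" by (auto simp: gns_of_genus_def)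
  obtain f where f: "f \<in> gaps S" "\<forall>y\<in>gaps S. (y, f) \<in> r"
    and mf: "multiplicity r S \<prec>\<^bsub>r\<^esub> f"
    using not_ordinaryE[OF gns False] by blast
  note sg = greatest_gap_special[OF gns f]
  \<comment> \<open>The removal takes place in the enlarged semigroup, so minimality is needed there
    and not just in \<open>S\<close>.\<close>
  have "multiplicity r S \<in> minimal_generators (insert f S)"
    using multiplicity_minimal_generator[OF gns_insert_special_gap[OF gns sg]]
      multiplicity_insert[OF gns sg] mf by simp
  then have "gns (ordinarization r S)"
    using gns_remove_minimal_generator gns_insert_special_gap[OF gns sg] ordinarization_eq[OF False f]
    by simp
  moreover have "genus (ordinarization r S) = g"
    using genus_exchange[OF gns _ multiplicity(1)[OF gns], of f] f(1) \<open>genus S = g\<close>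
    by (simp add: ordinarization_eq[OF False f] gaps_def)
  ultimately show ?thesis by (simp add: gns_of_genus_def)
qed

lemma ordinarization_decreases:
  assumes S: "S \<in> gns_of_genus g" and neq: "S \<noteq> ordinary_gns r g"
  defines "\<mu> \<equiv> \<lambda>S. card (gaps S - gaps (ordinary_gns r g))"
  shows "\<mu> (ordinarization r S) < \<mu> S"
proof -
  let ?R = "ordinary_gns r g"
  from S have gns: "gns S" and gen: "genus S = g" by (auto simp: gns_of_genus_def)
  have no: "\<not> ordinary r S" using ordinary_unique neq gen by blast
  obtain f where f: "f \<in> gaps S" "\<forall>y\<in>gaps S. (y, f) \<in> r"
    and mf: "multiplicity r S \<prec>\<^bsub>r\<^esub> f"
    using not_ordinaryE[OF gns no] by blast
  have R: "gns ?R" "genus ?R = g" using ordinary_gns_mem by (auto simp: gns_of_genus_def)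
  have fin: "finite (gaps S)" "finite (gaps ?R)" using gns R gns_finite_gaps by blast+
  have gapsR: "gaps ?R = {t. (t, nth_element r g) \<in> r} - {0}"
    unfolding ordinary_gns_def by (rule gaps_above)
  have card: "card (gaps S) = card (gaps ?R)" using gen R by (simp add: genus_def)
  have gaps_neq: "gaps S \<noteq> gaps ?R" using neq by (auto simp: gaps_def)
  \<comment> \<open>Otherwise all gaps of \<open>S\<close>, being at most \<open>f\<close>, would be
    gaps of \<open>?R\<close>; equal genus would then force \<open>S = ?R\<close>.\<close>
  have f_notin: "f \<notin> gaps ?R"
  proof
    assume "f \<in> gaps ?R"
    then have "gaps S \<subseteq> gaps ?R"
      using f(2) le_trans gns_zero[OF gns] unfolding gapsR by (force simp: gaps_def[of S])
    with card gaps_neq card_subset_eq[OF fin(2)] show False by blast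
  qed
  \<comment> \<open>By equal genus some gap of \<open>?R\<close> lies in \<open>S\<close>; the
    multiplicity is at most that element.\<close>
  have m_in: "multiplicity r S \<in> gaps ?R"
  proof -
    have "\<not> gaps ?R \<subseteq> gaps S"
      using card gaps_neq card_subset_eq[OF fin(1)] by metis
    then obtain s where "s \<in> gaps ?R" "s \<in> S" by (auto simp: gaps_def)
    then show ?thesis
      using multiplicity(2,3)[OF gns] le_trans unfolding gapsR by blast
  qed
  \<comment> \<open>The lost gap \<open>f\<close> was counted; the new gap, the multiplicity, is
    not.\<close>
  have "gaps (ordinarization r S) - gaps ?R \<subset> gaps S - gaps ?R"
    using f(1) f_notin m_in unfolding ordinarization_eq[OF no f] by (auto simp: gaps_def)
  then show ?thesis unfolding \<mu>_def using fin(1) by (intro psubset_card_mono) auto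
qed

lemma rooted_tree_ordinarization_graph:
  "rooted_tree (ordinarization_graph r g) (ordinary_gns r g)"
proof (rule rooted_treeI[where \<mu> = "\<lambda>S. card (gaps S - gaps (ordinary_gns r g))"])
  show "wf_digraph (ordinarization_graph r g)"
    by unfold_locales (auto simp: ordinarization_graph_def intro: ordinarization_mem)
  fix e assume "e \<in> arcs (ordinarization_graph r g)"
  then obtain S where "S \<in> gns_of_genus g" "S \<noteq> ordinary_gns r g" and e: "e = (S, ordinarization r S)"
    unfolding ordinarization_graph_def by auto
  from ordinarization_decreases[OF this(1,2)]
  show "card (gaps (head (ordinarization_graph r g) e) - gaps (ordinary_gns r g))
      < card (gaps (tail (ordinarization_graph r g) e) - gaps (ordinary_gns r g))"
    by (simp add: ordinarization_graph_def e)
\<comment> \<open>Arcs are pairs \<open>(S, ordinarization r S)\<close> with \<open>S\<close> not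
  the root, so an arc is determined by its tail.\<close>
qed (use ordinary_gns_mem in \<open>auto simp: ordinarization_graph_def\<close>)

section \<open>Sons of a vertex\<close>

lemma sons_ordinarization_graph:
  "sons (ordinarization_graph r g) T =
     {S \<in> gns_of_genus g. S \<noteq> ordinary_gns r g \<and> ordinarization r S = T}"
  by (auto simp: sons_def ordinarization_graph_def arcs_ends_def arc_to_ends_def)

lemma son_form:
  assumes S: "S \<in> gns_of_genus g" and neq: "S \<noteq> ordinary_gns r g" and T: "ordinarization r S = T"
  shows "\<exists>h x. S = (T \<union> {h}) - {x} \<and> h \<in> special_gaps T \<and> h \<prec>\<^bsub>r\<^esub> multiplicity r T \<and>
            x \<in> effective_generators r (T \<union> {h}) - {h}"
proof -
  from S have gns: "gns S" and gen: "genus S = g" by (auto simp: gns_of_genus_def)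
  have no: "\<not> ordinary r S" using ordinary_unique neq gen by blast
  obtain f where f: "f \<in> gaps S" "\<forall>y\<in>gaps S. (y, f) \<in> r"
    and mf: "multiplicity r S \<prec>\<^bsub>r\<^esub> f"
    using not_ordinaryE[OF gns no] by blast
  define m where "m = multiplicity r S"
  note m = multiplicity[OF gns, folded m_def] and mf = mf[folded m_def]
  have T: "T = insert f S - {m}" using T ordinarization_eq[OF no f] m_def by simp
  note sg = greatest_gap_special[OF gns f]
  have U: "T \<union> {m} = insert f S" using m T by auto
  have gnsU: "gns (insert f S)" by (rule gns_insert_special_gap[OF gns sg])
  have gnsT: "gns T" using ordinarization_mem[OF S] assms(3) by (simp add: gns_of_genus_def)
  have "f \<notin> S" using f(1) by (simp add: gaps_def)
  \<comment> \<open>The sum stays in the enlarged semigroup and is not the deleted \<open>m\<close>.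
    Taking \<open>s = m\<close> covers the doubling condition.\<close>
  have sum: "m + s \<in> T" if "s \<in> insert f S" "s \<noteq> 0" for s
  proof -
    have "m + s \<in> insert f S" using gns_add[OF gnsU, of m s] m(1) that by blast
    moreover have "m + s \<noteq> m" using that(2) by simp
    ultimately show ?thesis using T by blast
  qed
  have "m \<in> special_gaps T"
    using sum T m by (auto simp: special_gaps_def two_scale gaps_def)
  moreover have "m \<prec>\<^bsub>r\<^esub> multiplicity r T"
  proof -
    have "multiplicity r T \<in> insert f S" "multiplicity r T \<noteq> m"
      using multiplicity(1)[OF gnsT] by (auto simp: T)
    then show ?thesis using multiplicity(2)[OF gnsT] m(3)[of "multiplicity r T"] mf by auto
  qed
  moreover have "f \<in> minimal_generators (insert f S)"
  proof -
    \<comment> \<open>Summands both in \<open>S\<close> have their sum in \<open>S\<close>; if one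
      is \<open>f\<close>, the other would be zero.\<close>
    have "f \<noteq> a + b" if "a \<in> insert f S - {0}" "b \<in> insert f S - {0}" for a b
      using that \<open>f \<notin> S\<close> gns_add[OF gns, of a b] by auto
    moreover have "f \<noteq> 0" using gns_zero[OF gns] \<open>f \<notin> S\<close> by blast
    ultimately show ?thesis by (auto simp: minimal_generators_def)
  qed
  then have "f \<in> effective_generators r (T \<union> {m}) - {m}"
    unfolding U using f(2) mf by (auto simp: effective_generators_def ext_below_frobenius_iff[OF gnsU] gaps_def)
  moreover have "S = (T \<union> {m}) - {f}" using U \<open>f \<notin> S\<close> by auto
  ultimately show ?thesis by blast
qed

text \<open>In \<open>S\<close>, \<open>h\<close> is the least nonzero element and \<open>x\<close>
  the greatest gap, so the transform swaps them back and returns \<open>T\<close>.\<close>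

lemma form_son:
  assumes T: "T \<in> gns_of_genus g" and h: "h \<in> special_gaps T" "h \<prec>\<^bsub>r\<^esub> multiplicity r T"
    and x: "x \<in> effective_generators r (T \<union> {h}) - {h}"
  defines "S \<equiv> (T \<union> {h}) - {x}"
  shows "S \<in> gns_of_genus g" and "S \<noteq> ordinary_gns r g" and "ordinarization r S = T"
proof -
  from T have gns: "gns T" and gen: "genus T = g" by (auto simp: gns_of_genus_def)
  have gnsU: "gns (T \<union> {h})" using gns_insert_special_gap[OF gns h(1)] by simp
  have "h \<notin> T" using h(1) by (simp add: special_gaps_def gaps_def)
  have "h \<noteq> 0" using \<open>h \<notin> T\<close> gns_zero[OF gns] by blast
  have xmin: "x \<in> minimal_generators (T \<union> {h})" and xgap: "\<And>y. y \<in> gaps (T \<union> {h}) \<Longrightarrow> y \<prec>\<^bsub>r\<^esub> x"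
    and "x \<noteq> h"
    using x ext_below_frobenius_iff[OF gnsU, of x] unfolding effective_generators_def by blast+
  have "x \<in> T" "x \<noteq> 0" using xmin \<open>x \<noteq> h\<close> by (auto simp: minimal_generators_def)
  have hT: "h \<prec>\<^bsub>r\<^esub> y" if "y \<in> T" "y \<noteq> 0" for y
    using multiplicity(3)[OF gns that] h(2) le_trans \<open>h \<notin> T\<close> that by metis
  have gnsS: "gns S" unfolding S_def by (rule gns_remove_minimal_generator[OF gnsU xmin])
  show "S \<in> gns_of_genus g"
    using gnsS genus_exchange[OF gns \<open>h \<notin> T\<close> \<open>x \<in> T\<close>] gen by (simp add: gns_of_genus_def S_def)
  \<comment> \<open>\<open>h\<close> lies in \<open>S\<close> and below \<open>x\<close>, which was
    removed.\<close>
  have no: "\<not> ordinary r S"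
    by (rule not_ordinaryI[of h _ x]) (use hT \<open>x \<in> T\<close> \<open>x \<noteq> 0\<close> \<open>h \<noteq> 0\<close> \<open>x \<noteq> h\<close> in \<open>auto simp: S_def\<close>)
  then show "S \<noteq> ordinary_gns r g" using ordinary_ordinary_gns by blast
  have "multiplicity r S = h"
    unfolding multiplicity_def
    by (rule least_wrt_eqI) (use hT le_refl \<open>h \<noteq> 0\<close> \<open>x \<noteq> h\<close> in \<open>auto simp: S_def\<close>)
  \<comment> \<open>The gaps of \<open>S\<close> are \<open>x\<close> and those of
    \<open>T \<union> {h}\<close>, all of which lie below \<open>x\<close>.\<close>
  moreover have "x \<in> gaps S" "\<forall>y\<in>gaps S. (y, x) \<in> r"
    using xgap le_refl by (auto simp: gaps_def S_def)
  ultimately show "ordinarization r S = T"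
    using ordinarization_eq[OF no] \<open>h \<notin> T\<close> \<open>x \<in> T\<close> by (auto simp: S_def)
qed

end

theorem theorem24:
  fixes r :: "(nat ^ 'd) rel" and g :: nat
  assumes "relaxed_monomial_order r"
  shows "rooted_tree (ordinarization_graph r g) (ordinary_gns r g) \<and>
    (\<forall>T \<in> gns_of_genus g.
       sons (ordinarization_graph r g) T =
         {(T \<union> {h}) - {x} | h x. h \<in> special_gaps T \<and> h \<prec>\<^bsub>r\<^esub> multiplicity r T \<and>
            x \<in> effective_generators r (T \<union> {h}) - {h}})"
proof -
  interpret relaxed_order r by unfold_locales (rule assms)
  have "sons (ordinarization_graph r g) T =
         {(T \<union> {h}) - {x} | h x. h \<in> special_gaps T \<and> h \<prec>\<^bsub>r\<^esub> multiplicity r T \<and>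
            x \<in> effective_generators r (T \<union> {h}) - {h}}" (is "_ = ?B")
    if T: "T \<in> gns_of_genus g" for T
  proof
    show "sons (ordinarization_graph r g) T \<subseteq> ?B"
    proof
      fix S assume "S \<in> sons (ordinarization_graph r g) T"
      then have S: "S \<in> gns_of_genus g" "S \<noteq> ordinary_gns r g" "ordinarization r S = T"
        by (simp_all add: sons_ordinarization_graph)
      show "S \<in> ?B" by (rule CollectI) (rule son_form[OF S])
    qed
    show "?B \<subseteq> sons (ordinarization_graph r g) T"
    proof
      fix S assume "S \<in> ?B"
      then obtain h x where "S = (T \<union> {h}) - {x}"
        and hx: "h \<in> special_gaps T" "h \<prec>\<^bsub>r\<^esub> multiplicity r T"
          "x \<in> effective_generators r (T \<union> {h}) - {h}"
        by (elim CollectE exE conjE) (rule that, (assumption | rule conjI)+)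
      then show "S \<in> sons (ordinarization_graph r g) T"
        using form_son[OF T hx] by (simp only: sons_ordinarization_graph mem_Collect_eq) simp
    qed
  qed
  then show ?thesis using rooted_tree_ordinarization_graph by blast
qed

end
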